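(* Let $\mathbb{F}$ be a field and let $L$ be the four-dimensional filiform Lie algebra over $\mathbb{F}$ with basis $e_1,e_2,e_3,e_4$ whose only nonzero brackets of basis vectors (up to antisymmetry) are $[e_1,e_2]=e_3$ and $[e_1,e_3]=e_4$. Let $\mathcal{L}$, $\mathcal{P}_2$, $\mathcal{P}_3$ be the sets of one-, two- and three-dimensional subalgebras of $L$. Then: (1) The three-dimensional subalgebras are exactly those of the form $\mathcal{P}_3(\lambda,\mu)=\mathbb{F}e_3+\mathbb{F}e_4+\mathbb{F}(\lambda e_1+\mu e_2)$ with $(\lambda,\mu)\neq(0,0)$. If $\lambda\neq 0$ these are Heisenberg algebras; if $\lambda=0$ it is abelian. When $\mathbb{F}=\mathbb{F}_q$ there are $q+1$ of these in total. (2) The two-dimensional subalgebras are exactly the two-dimensional subspaces of $\mathbb{F}e_2+\mathbb{F}e_3+\mathbb{F}e_4$ together with the subspaces $\mathbb{F}(e_1+\alpha e_2+\beta e_3)+\mathbb{F}e_4$ with $\alpha,\beta\in\mathbb{F}$. When $\mathbb{F}=\mathbb{F}_q$ there are $2q^2+q+1$ of these. (3) If $A,B\in\mathcal{P}_3$ with $A\neq B$, then $A\sim B$ in $\Gamma(L)$. So, if $\mathbb{F}=\mathbb{F}_q$, the induced subgraph of $\Gamma(L)$ on $\mathcal{P}_3$ is the complete graph $K_{q+1}$. (4) If $A,B\in\mathcal{P}_2$, then $A\sim B$ if and only if $A$ and $B$ are not both contained in the same member of $\mathcal{P}_3$. (5) If $A\in\mathcal{L}$ and $B\in\mathcal{P}_2$,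 then $A\sim B$ if and only if $A$ and $B$ are not both contained in the same member of $\mathcal{P}_3$.
   Context: For a finite-dimensional Lie algebra $L$, the comaximal graph $\Gamma(L)$ is the simple undirected graph whose vertices are the proper nonzero Lie subalgebras of $L$; two distinct vertices $A,B$ are adjacent (written $A\sim B$) if and only if the Lie subalgebra $\langle A,B\rangle$ generated by $A\cup B$ equals $L$. A Heisenberg algebra here is a Lie algebra isomorphic to the three-dimensional one with basis $a,b,c$ and $[a,b]=c$, $[a,c]=[b,c]=0$. *)

theory Defs
  imports "HOL-Library.Product_Plus" "HOL-Library.Cardinality" "Graph_Theory.Kuratowski"
begin

text \<open>
  A Lie algebra over the field \<open>'k\<close> has as carrier the whole type \<open>'v\<close>; its subalgebras are sets.
  Alternation is stated as \<open>[x, x] = 0\<close>, so that characteristic 2 is treated correctly.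
\<close>

locale lie_algebra = vector_space scale
  for scale :: "'k::field \<Rightarrow> 'v::ab_group_add \<Rightarrow> 'v" (infixr \<open>*s\<close> 75) +
  fixes bracket :: "'v \<Rightarrow> 'v \<Rightarrow> 'v"
  assumes bracket_add_left: "bracket (x + y) z = bracket x z + bracket y z"
    and bracket_add_right: "bracket x (y + z) = bracket x y + bracket x z"
    and bracket_scale_left: "bracket (a *s x) y = a *s bracket x y"
    and bracket_scale_right: "bracket x (a *s y) = a *s bracket x y"
    and bracket_self: "bracket x x = 0"
    and jacobi: "bracket x (bracket y z) + bracket y (bracket z x) + bracket z (bracket x y) = 0"
begin

definition subalgebra :: "'v set \<Rightarrow> bool" where
  "subalgebra A \<longleftrightarrow> subspace A \<and> (\<forall>x\<in>A. \<forall>y\<in>A. bracket x y \<in> A)"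

definition subalgebras_of_dim :: "nat \<Rightarrow> 'v set set" where
  "subalgebras_of_dim n = {A. subalgebra A \<and> dim A = n}"

definition generated_subalgebra :: "'v set \<Rightarrow> 'v set" where
  "generated_subalgebra S = subalgebra hull S"

definition abelian :: "'v set \<Rightarrow> bool" where
  "abelian A \<longleftrightarrow> (\<forall>x\<in>A. \<forall>y\<in>A. bracket x y = 0)"

text \<open>
  As usual in \<open>Graph_Theory\<close>, a simple undirected graph is a symmetric loop-free digraph without
  parallel arcs. Symmetry is inherited from \<open>A \<union> B = B \<union> A\<close>.
\<close>

definition comaximal_graph :: "'v set pair_pre_digraph" where
  "comaximal_graph =
    (let V = {A. subalgebra A \<and> A \<noteq> {0} \<and> A \<noteq> UNIV}
     in \<lparr> pverts = V,
          parcs = {(A, B). A \<in> V \<and> B \<in> V \<and> A \<noteq> B \<and> generated_subalgebra (A \<union> B) = UNIV} \<rparr>)"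

end

text \<open>
  Isomorphism of a subalgebra \<open>A\<close> of one Lie algebra with a subalgebra \<open>B\<close> of another: a bijective
  linear map that preserves brackets.
\<close>

definition lie_isomorphic ::
  "('k::field \<Rightarrow> 'v::ab_group_add \<Rightarrow> 'v) \<Rightarrow> ('v \<Rightarrow> 'v \<Rightarrow> 'v) \<Rightarrow> 'v set \<Rightarrow>
   ('k \<Rightarrow> 'w::ab_group_add \<Rightarrow> 'w) \<Rightarrow> ('w \<Rightarrow> 'w \<Rightarrow> 'w) \<Rightarrow> 'w set \<Rightarrow> bool" where
  "lie_isomorphic s br A s' br' B \<longleftrightarrow>
    (\<exists>f. bij_betw f A B \<and>
      (\<forall>x\<in>A. \<forall>y\<in>A. f (x + y) = f x + f y) \<and>
      (\<forall>c. \<forall>x\<in>A. f (s c x) = s' c (f x)) \<and>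
      (\<forall>x\<in>A. \<forall>y\<in>A. f (br x y) = br' (f x) (f y)))"

text \<open>
  The three-dimensional Heisenberg algebra in coordinates with respect to its basis \<open>a\<close>, \<open>b\<close>, \<open>c\<close>,
  where \<open>[a, b] = c\<close> and \<open>[a, c] = [b, c] = 0\<close>.
\<close>

fun heisenberg_scale :: "'k::field \<Rightarrow> 'k \<times> 'k \<times> 'k \<Rightarrow> 'k \<times> 'k \<times> 'k" where
  "heisenberg_scale t (x, y, z) = (t * x, t * y, t * z)"

fun heisenberg_bracket :: "'k::field \<times> 'k \<times> 'k \<Rightarrow> 'k \<times> 'k \<times> 'k \<Rightarrow> 'k \<times> 'k \<times> 'k" where
  "heisenberg_bracket (x1, x2, x3) (y1, y2, y3) = (0, 0, x1 * y2 - x2 * y1)"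

lemma lie_algebra_heisenberg: "lie_algebra heisenberg_scale heisenberg_bracket"
  by unfold_locales (auto simp: algebra_simps zero_prod_def)

lemma heisenberg_bracket_basis:
  "heisenberg_bracket (1, 0, 0) (0, 1, 0) = (0, 0, 1)"
  "heisenberg_bracket (1, 0, 0) (0, 0, 1) = 0"
  "heisenberg_bracket (0, 1, 0) (0, 0, 1) = 0"
  by (simp_all add: zero_prod_def)

definition (in lie_algebra) heisenberg :: "'v set \<Rightarrow> bool" where
  "heisenberg A \<longleftrightarrow>
    subalgebra A \<and> lie_isomorphic scale bracket A heisenberg_scale heisenberg_bracket UNIV"

locale filiform4 = lie_algebra scale bracket
  for scale :: "'k::field \<Rightarrow> 'v::ab_group_add \<Rightarrow> 'v" (infixr \<open>*s\<close> 75)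
    and bracket :: "'v \<Rightarrow> 'v \<Rightarrow> 'v" +
  fixes e1 e2 e3 e4 :: 'v
  assumes distinct_basis: "distinct [e1, e2, e3, e4]"
    and independent_basis: "independent {e1, e2, e3, e4}"
    and span_basis: "span {e1, e2, e3, e4} = UNIV"
    and bracket_12: "bracket e1 e2 = e3"
    and bracket_13: "bracket e1 e3 = e4"
    and bracket_14: "bracket e1 e4 = 0"
    and bracket_23: "bracket e2 e3 = 0"
    and bracket_24: "bracket e2 e4 = 0"
    and bracket_34: "bracket e3 e4 = 0"

end

theory Submission
  imports Defs
begin

text \<open>
  Let \<open>V = span {e2, e3, e4}\<close>, an abelian ideal. If a subalgebra \<open>A\<close> contains some \<open>x \<notin> V\<close> and some
  \<open>y \<in> V\<close> outside \<open>span {e4}\<close>, then bracketing \<open>y\<close> with \<open>x\<close> once or twice puts \<open>e3\<close> and \<open>e4\<close> into \<open>A\<close>.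
  Hence a three-dimensional subalgebra contains \<open>e3\<close> and \<open>e4\<close>, and a two-dimensional one not inside \<open>V\<close>
  meets \<open>V\<close> in \<open>span {e4}\<close>. In particular every two-dimensional subalgebra lies in a three-dimensional
  one. For (4) and (5), if \<open>A \<subseteq> B\<close> this gives a common three-dimensional subalgebra; otherwise the
  subalgebra generated by \<open>A\<close> and \<open>B\<close> has dimension at least 3, so it is either everything or itself
  a common three-dimensional subalgebra.
\<close>

section \<open>Subalgebras, generation and adjacency in a general Lie algebra\<close>

context lie_algebra
begin

text \<open>Polarisation of alternation: expanding \<open>[x + y, x + y] = 0\<close> leaves only the
  mixed terms, in every characteristic.\<close>

lemma bracket_antisym: "bracket y x = - bracket x y"
proof -
  have "bracket (x + y) (x + y) = 0"
    by (rule bracket_self)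
  then have "bracket y x + bracket x y = 0"
    by (simp add: bracket_add_left bracket_add_right bracket_self[of x] bracket_self[of y])
  then show ?thesis
    by (simp add: eq_neg_iff_add_eq_0)
qed

lemma subalgebra_subspace: "subalgebra A \<Longrightarrow> subspace A"
  by (simp add: subalgebra_def)

lemma subalgebra_bracket: "subalgebra A \<Longrightarrow> x \<in> A \<Longrightarrow> y \<in> A \<Longrightarrow> bracket x y \<in> A"
  by (simp add: subalgebra_def)

lemma subalgebra_Inter: "(\<And>A. A \<in> \<A> \<Longrightarrow> subalgebra A) \<Longrightarrow> subalgebra (\<Inter>\<A>)"
  unfolding subalgebra_def by (blast intro: subspace_Inter)

lemma subalgebra_generated: "subalgebra (generated_subalgebra S)"
  unfolding generated_subalgebra_def by (rule hull_in) (simp add: subalgebra_Inter)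

lemma generated_superset: "S \<subseteq> generated_subalgebra S"
  unfolding generated_subalgebra_def by (rule hull_subset)

lemma generated_minimal: "S \<subseteq> A \<Longrightarrow> subalgebra A \<Longrightarrow> generated_subalgebra S \<subseteq> A"
  unfolding generated_subalgebra_def by (rule hull_minimal)

lemma comaximal_graph_adj:
  "A \<rightarrow>\<^bsub>comaximal_graph\<^esub> B \<longleftrightarrow>
    subalgebra A \<and> A \<noteq> {0} \<and> A \<noteq> UNIV \<and> subalgebra B \<and> B \<noteq> {0} \<and> B \<noteq> UNIV \<and>
    A \<noteq> B \<and> generated_subalgebra (A \<union> B) = UNIV"
  by (auto simp: comaximal_graph_def Let_def)

end

section \<open>Coordinates in the filiform algebra\<close>

context filiform4
begin

sublocale finite_dimensional_vector_space scale "{e1, e2, e3, e4}"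
  using independent_basis span_basis by unfold_locales auto

lemma basis_neq [simp]:
  "e1 \<noteq> e2" "e1 \<noteq> e3" "e1 \<noteq> e4" "e2 \<noteq> e3" "e2 \<noteq> e4" "e3 \<noteq> e4"
  "e2 \<noteq> e1" "e3 \<noteq> e1" "e4 \<noteq> e1" "e3 \<noteq> e2" "e4 \<noteq> e2" "e4 \<noteq> e3"
  using distinct_basis by auto

text \<open>Coordinate vectors: once every vector is written as a \<open>comb\<close>, equality,
  membership and brackets become equations in the field.\<close>

definition comb :: "'k \<Rightarrow> 'k \<Rightarrow> 'k \<Rightarrow> 'k \<Rightarrow> 'v" where
  "comb a b c d = a *s e1 + b *s e2 + c *s e3 + d *s e4"

lemma comb_add: "comb a b c d + comb a' b' c' d' = comb (a + a') (b + b') (c + c') (d + d')"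
  by (simp add: comb_def algebra_simps)

lemma comb_diff: "comb a b c d - comb a' b' c' d' = comb (a - a') (b - b') (c - c') (d - d')"
  by (simp add: comb_def algebra_simps)

lemma comb_add_e4: "comb a b c d + k *s e4 = comb a b c (d + k)"
  by (simp add: comb_def algebra_simps)

lemma comb_scale: "t *s comb a b c d = comb (t * a) (t * b) (t * c) (t * d)"
  by (simp add: comb_def algebra_simps)

lemma comb_eq_0: "comb a b c d = 0 \<longleftrightarrow> a = 0 \<and> b = 0 \<and> c = 0 \<and> d = 0"
proof
  assume eq: "comb a b c d = 0"
  \<comment> \<open>The independence criterion expects a coefficient function on the basis; the last
    \<open>else\<close> branch is the value at \<open>e4\<close>.\<close>
  define u where "u v = (if v = e1 then a else if v = e2 then b else if v = e3 then c else d)" for v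
  have "(\<Sum>v\<in>{e1, e2, e3, e4}. u v *s v) = 0"
    using eq by (simp add: u_def comb_def add.assoc)
  then have u: "u v = 0" if "v \<in> {e1, e2, e3, e4}" for v
    using independentD[OF independent_basis _ order_refl _ that, of u] by simp
  show "a = 0 \<and> b = 0 \<and> c = 0 \<and> d = 0"
    using u[of e1] u[of e2] u[of e3] u[of e4] by (simp add: u_def)
qed (simp add: comb_def)

lemma comb_inject:
  "comb a b c d = comb a' b' c' d' \<longleftrightarrow> a = a' \<and> b = b' \<and> c = c' \<and> d = d'"
  using comb_eq_0[of "a - a'" "b - b'" "c - c'" "d - d'"] by (auto simp flip: comb_diff)

lemma comb_cases:
  obtains a b c d where "x = comb a b c d"
proof -
  have "x \<in> span {e1, e2, e3, e4}"
    by (simp add: span_basis)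
  then obtain a b c d where "x - a *s e1 - b *s e2 - c *s e3 - d *s e4 = 0"
    by (auto simp: span_breakdown_eq)
  then have "x = comb a b c d"
    by (simp add: comb_def algebra_simps)
  then show thesis ..
qed

lemma bracket_comb:
  "bracket (comb a b c d) (comb a' b' c' d') = comb 0 0 (a * b' - b * a') (a * c' - c * a')"
proof -
  have "bracket e2 e1 = - e3" "bracket e3 e1 = - e4" "bracket e4 e1 = 0"
    "bracket e3 e2 = 0" "bracket e4 e2 = 0" "bracket e4 e3 = 0"
    using bracket_antisym[of e2 e1] bracket_antisym[of e3 e1] bracket_antisym[of e4 e1]
      bracket_antisym[of e3 e2] bracket_antisym[of e4 e2] bracket_antisym[of e4 e3]
    by (simp_all add: bracket_12 bracket_13 bracket_14 bracket_23 bracket_24 bracket_34)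
  then show ?thesis
    by (simp add: comb_def bracket_add_left bracket_add_right bracket_scale_left
        bracket_scale_right bracket_self bracket_12 bracket_13 bracket_14 bracket_23 bracket_24
        bracket_34 algebra_simps)
qed

section \<open>The subspaces \<open>V\<close>, \<open>P\<close> and \<open>Q\<close>: membership,
  dimension and structure\<close>

abbreviation "V \<equiv> span {e2, e3, e4}"
abbreviation "P l m \<equiv> span {e3, e4, l *s e1 + m *s e2}"
abbreviation "Q a b \<equiv> span {e1 + a *s e2 + b *s e3, e4}"

lemmas comb_simps = comb_add comb_diff comb_scale comb_eq_0 comb_inject

text \<open>\<open>span_breakdown_eq\<close> tests membership by subtracting multiples of the
  generators one at a time. These rules put each such difference back into coordinates, for all
  generators used below.\<close>

lemma comb_diff_scale:
  "comb a b c d - k *s e1 = comb (a - k) b c d"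
  "comb a b c d - k *s e2 = comb a (b - k) c d"
  "comb a b c d - k *s e3 = comb a b (c - k) d"
  "comb a b c d - k *s e4 = comb a b c (d - k)"
  "comb a b c d - k *s (l *s e1 + m *s e2) = comb (a - k * l) (b - k * m) c d"
  "comb a b c d - k *s (e1 + s *s e2 + t *s e3) = comb (a - k) (b - k * s) (c - k * t) d"
  "comb a b c d - k *s (e2 + s *s e3) = comb a (b - k) (c - k * s) d"
  "comb a b c d - k *s (e2 + s *s e4) = comb a (b - k) c (d - k * s)"
  "comb a b c d - k *s (e3 + s *s e4) = comb a b (c - k) (d - k * s)"
  by (simp_all add: comb_def algebra_simps)

lemma dim_pair: "y \<noteq> 0 \<Longrightarrow> (\<And>k. x - k *s y \<noteq> 0) \<Longrightarrow> dim {x, y} = 2"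
  by (simp add: dim_insert span_breakdown_eq)

lemma comb_in_V: "comb a b c d \<in> V \<longleftrightarrow> a = 0"
  by (simp add: span_breakdown_eq comb_diff_scale comb_eq_0)

text \<open>The multiplier \<open>t\<close> stays existential because either of \<open>l\<close> and
  \<open>m\<close> may vanish, so neither can be divided by uniformly.\<close>

lemma comb_in_P: "comb a b c d \<in> P l m \<longleftrightarrow> (\<exists>t. a = t * l \<and> b = t * m)"
  by (simp add: span_breakdown_eq comb_diff_scale comb_eq_0)

lemma comb_in_Q: "comb a b c d \<in> Q s t \<longleftrightarrow> b = a * s \<and> c = a * t"
  by (simp add: span_breakdown_eq comb_diff_scale comb_eq_0)

lemma comb_in_span34: "comb a b c d \<in> span {e3, e4} \<longleftrightarrow> a = 0 \<and> b = 0"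
  by (auto simp: span_breakdown_eq comb_diff_scale comb_eq_0)

lemma dim_span34: "dim {e3, e4} = 2"
proof (rule dim_pair)
  show "e4 \<noteq> 0"
    using comb_eq_0[of 0 0 0 1] by (simp add: comb_def)
  show "e3 - k *s e4 \<noteq> 0" for k
    using comb_eq_0[of 0 0 1 "- k"] by (simp add: comb_def algebra_simps)
qed

lemma dim_P: "dim (P l m) = (if (l, m) = (0, 0) then 2 else 3)"
proof -
  have "P l m = span (insert (l *s e1 + m *s e2) {e3, e4})"
    by (simp add: insert_commute)
  moreover have "l *s e1 + m *s e2 = comb l m 0 0"
    by (simp add: comb_def)
  ultimately show ?thesis
    by (simp only: dim_span dim_insert[of _ "{e3, e4}"] comb_in_span34 dim_span34) auto
qed

lemma V_eq_P: "V = P 0 1"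
  by (simp add: insert_commute)

lemma dim_V: "dim V = 3"
  unfolding V_eq_P dim_P by simp

lemma dim_Q: "dim (Q a b) = 2"
  unfolding dim_span
proof (rule dim_pair)
  show "e4 \<noteq> 0"
    using comb_eq_0[of 0 0 0 1] by (simp add: comb_def)
  show "e1 + a *s e2 + b *s e3 - k *s e4 \<noteq> 0" for k
    using comb_eq_0[of 1 a b "- k"] by (simp add: comb_def algebra_simps)
qed

lemma dim_whole: "dim UNIV = 4"
  by simp

text \<open>All brackets land in \<open>span {e3, e4}\<close>, which is the part of
  \<open>P l m\<close> with \<open>t = 0\<close>.\<close>

lemma subalgebra_P: "subalgebra (P l m)"
  unfolding subalgebra_def
proof (intro conjI ballI)
  fix x y assume "x \<in> P l m" "y \<in> P l m"
  then show "bracket x y \<in> P l m"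
    by (cases x rule: comb_cases; cases y rule: comb_cases)
      (auto simp: comb_in_P bracket_comb algebra_simps)
qed (rule subspace_span)

text \<open>On \<open>Q a b\<close> the second and third coordinates are fixed multiples of the
  first, so both minors in \<open>bracket_comb\<close> vanish.\<close>

lemma subalgebra_Q: "subalgebra (Q a b)"
  unfolding subalgebra_def
proof (intro conjI ballI)
  fix x y assume "x \<in> Q a b" "y \<in> Q a b"
  then show "bracket x y \<in> Q a b"
    by (cases x rule: comb_cases; cases y rule: comb_cases)
      (auto simp: comb_in_Q bracket_comb mult.commute mult.left_commute)
qed (rule subspace_span)

lemma abelian_V: "abelian V"
  unfolding abelian_def
proof (intro ballI)
  fix x y assume "x \<in> V" "y \<in> V"
  then show "bracket x y = 0"
    by (cases x rule: comb_cases; cases y rule: comb_cases)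
      (auto simp: comb_in_V bracket_comb comb_eq_0)
qed

lemma abelian_P_0: "m \<noteq> 0 \<Longrightarrow> abelian (P 0 m)"
proof -
  have "P 0 m \<subseteq> V"
    by (rule span_minimal) (auto intro: span_base span_scale subspace_span)
  then show ?thesis
    using abelian_V unfolding abelian_def by blast
qed

text \<open>The basis corresponding to \<open>a\<close>, \<open>b\<close>, \<open>c\<close> is \<open>l *s e1 + m *s e2\<close>, \<open>e3\<close>, \<open>l *s e4\<close>.\<close>

lemma heisenberg_P:
  assumes l: "l \<noteq> 0"
  shows "heisenberg (P l m)"
proof -
  define g where "g = (\<lambda>(t, u, w). comb (t * l) (t * m) u (w * l))"
  \<comment> \<open>The isomorphism must run from the subalgebra to the model. Its laws are checked
    on the coordinate map \<open>g\<close> and carried over to the inverse by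
    \<open>fg\<close>.\<close>
  define f where "f = the_inv g"
  have inj: "inj g"
    using l by (auto simp: inj_def g_def comb_inject)
  have fg: "f (g p) = p" for p
    unfolding f_def by (rule the_inv_f_f[OF inj])
  have range: "range g = P l m"
  proof (intro equalityI subsetI)
    fix x assume x: "x \<in> P l m"
    obtain a b c d where [simp]: "x = comb a b c d"
      by (rule comb_cases)
    obtain t where "a = t * l" "b = t * m"
      using x by (auto simp: comb_in_P)
    then have "x = g (t, c, d / l)"
      using l by (simp add: g_def)
    then show "x \<in> range g" by blast
  qed (auto simp: g_def comb_in_P)
  have g_add: "g p + g q = g (p + q)" for p q
    by (cases p; cases q) (simp add: g_def comb_add algebra_simps)
  have g_scale: "c *s g p = g (heisenberg_scale c p)" for c p
    by (cases p) (simp add: g_def comb_scale algebra_simps)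
  have g_bracket: "bracket (g p) (g q) = g (heisenberg_bracket p q)" for p q
    by (cases p; cases q) (simp add: g_def bracket_comb algebra_simps)
  have "bij_betw f (P l m) UNIV"
    unfolding f_def range[symmetric] using bij_betw_the_inv_into[of g UNIV "range g"] inj
    by (simp add: bij_betw_def)
  then have "lie_isomorphic scale bracket (P l m) heisenberg_scale heisenberg_bracket UNIV"
    unfolding lie_isomorphic_def range[symmetric]
    by (intro exI[of _ f]) (auto simp: g_add g_scale g_bracket fg)
  then show ?thesis
    by (simp add: heisenberg_def subalgebra_P)
qed

section \<open>Classification of the three-dimensional subalgebras\<close>

lemma not_subset_if_dim_less:
  assumes "dim S < dim A"
  obtains x where "x \<in> A" "x \<notin> span S"
  using assms dim_subset[of A "span S"] by force

lemma in_subspace_scaleD: "subspace A \<Longrightarrow> c *s x \<in> A \<Longrightarrow> c \<noteq> 0 \<Longrightarrow> x \<in> A"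
  using subspace_scale[of A "c *s x" "inverse c"] by simp

lemma P_subset_iff: "subspace A \<Longrightarrow> P l m \<subseteq> A \<longleftrightarrow> e3 \<in> A \<and> e4 \<in> A \<and> comb l m 0 0 \<in> A"
  using span_superset[of "{e3, e4, l *s e1 + m *s e2}"]
    span_minimal[of "{e3, e4, l *s e1 + m *s e2}" A]
  by (auto simp: comb_def)

lemma comb_mod_e3_e4:
  assumes "subspace A" "e3 \<in> A" "e4 \<in> A" "comb a b c d \<in> A"
  shows "comb a b 0 0 \<in> A"
proof -
  have "comb a b c d - (c *s e3 + d *s e4) \<in> A"
    using assms by (intro subspace_diff subspace_add subspace_scale)
  then show ?thesis by (simp add: comb_def)
qed

text \<open>Bracketing with the first element shifts \<open>e2\<close> to \<open>e3\<close> to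
  \<open>e4\<close>, up to nonzero factors. If \<open>b \<noteq> 0\<close>, two brackets give
  \<open>e4\<close> and one gives \<open>e3\<close> modulo \<open>e4\<close>. If
  \<open>b = 0\<close>, one bracket gives \<open>e4\<close> and the second element itself gives
  \<open>e3\<close> modulo \<open>e4\<close>.\<close>

lemma derived_in_subalgebra:
  assumes A: "subalgebra A" and x: "comb a p q r \<in> A" "a \<noteq> 0"
    and y: "comb 0 b c d \<in> A" "b \<noteq> 0 \<or> c \<noteq> 0"
  shows "e3 \<in> A" "e4 \<in> A"
proof -
  note sub = subalgebra_subspace[OF A]
  have xy: "comb 0 0 (a * b) (a * c) \<in> A"
    using subalgebra_bracket[OF A x(1) y(1)] by (simp add: bracket_comb)
  have xxy: "comb 0 0 0 (a * (a * b)) \<in> A"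
    using subalgebra_bracket[OF A x(1) xy] by (simp add: bracket_comb)
  show e4: "e4 \<in> A"
  proof (cases "b = 0")
    case True
    then show ?thesis
      using xy x(2) y(2) in_subspace_scaleD[OF sub, of "a * c" e4] by (simp add: comb_def)
  next
    case False
    then show ?thesis
      using xxy x(2) in_subspace_scaleD[OF sub, of "a * (a * b)" e4] by (simp add: comb_def)
  qed
  show "e3 \<in> A"
  proof (cases "b = 0")
    case True
    have "comb 0 0 c d - d *s e4 \<in> A"
      using True y(1) e4 by (auto intro: subspace_diff subspace_scale sub)
    then show ?thesis
      using True y(2) in_subspace_scaleD[OF sub, of c e3] by (simp add: comb_def)
  next
    case False
    have "comb 0 0 (a * b) (a * c) - (a * c) *s e4 \<in> A"
      using xy e4 by (auto intro: subspace_diff subspace_scale sub)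
    then show ?thesis
      using False x(2) in_subspace_scaleD[OF sub, of "a * b" e3] by (simp add: comb_def)
  qed
qed

text \<open>One step of Gaussian elimination with pivot \<open>a\<close>; it produces elements of
  \<open>A\<close> inside \<open>V\<close>.\<close>

lemma eliminate_e1:
  assumes "subspace A" "comb a p q r \<in> A" "a \<noteq> 0" "comb a' b c d \<in> A"
  shows "comb 0 (b - a' / a * p) (c - a' / a * q) (d - a' / a * r) \<in> A"
proof -
  have "comb a' b c d - (a' / a) *s comb a p q r \<in> A"
    using assms by (intro subspace_diff subspace_scale)
  then show ?thesis using assms(3) by (simp add: comb_simps)
qed

lemma not_in_V_cases:
  assumes "\<not> A \<subseteq> V"
  obtains a p q r where "comb a p q r \<in> A" "a \<noteq> 0"
proof -
  obtain x where "x \<in> A" "x \<notin> V"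
    using assms by blast
  then show thesis
    using that by (cases x rule: comb_cases) (auto simp: comb_in_V)
qed

text \<open>Modulo \<open>span {e3, e4}\<close> the space \<open>A\<close> is a line;
  \<open>l\<close> and \<open>m\<close> are the coordinates of a vector spanning it.\<close>

lemma eq_P_if_derived_in:
  assumes sub: "subspace A" and dim: "dim A = 3" and e: "e3 \<in> A" "e4 \<in> A"
  obtains l m where "(l, m) \<noteq> (0, 0)" "A = P l m"
proof -
  obtain x where x: "x \<in> A" "x \<notin> span {e3, e4}"
    using not_subset_if_dim_less[of "{e3, e4}" A] dim dim_span34 by auto
  obtain l m c d where [simp]: "x = comb l m c d"
    by (rule comb_cases)
  have nz: "(l, m) \<noteq> (0, 0)"
    using x(2) by (auto simp: comb_in_span34)
  have "P l m \<subseteq> A"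
    using comb_mod_e3_e4[OF sub e] x(1) P_subset_iff[OF sub] e by simp
  moreover have dimP: "dim (P l m) = 3"
    unfolding dim_P using nz by simp
  ultimately have "P l m = A"
    by (intro subspace_dim_equal sub subspace_span) (simp_all only: dim dimP order_refl)
  then show thesis
    using nz that by blast
qed

lemma dim3_subalgebra_cases:
  assumes A: "subalgebra A" and dim: "dim A = 3"
  obtains l m where "(l, m) \<noteq> (0, 0)" "A = P l m"
proof (cases "A \<subseteq> V")
  case True
  then have "A = P 0 1"
    using dim dim_V subalgebra_subspace[OF A] V_eq_P by (metis subspace_dim_equal order_refl subspace_span)
  then show thesis
    using that[of 0 1] by simp
next
  case False
  note sub = subalgebra_subspace[OF A]
  obtain a p q r where x: "comb a p q r \<in> A" "a \<noteq> 0"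
    using False by (rule not_in_V_cases)
  let ?x = "comb a p q r"
  have "\<exists>b c d. comb 0 b c d \<in> A \<and> (b \<noteq> 0 \<or> c \<noteq> 0)"
  proof (rule ccontr)
    assume none: "\<not> (\<exists>b c d. comb 0 b c d \<in> A \<and> (b \<noteq> 0 \<or> c \<noteq> 0))"
    \<comment> \<open>If \<open>A\<close> met \<open>V\<close> only inside \<open>span {e4}\<close>,
      elimination would leave two generators for \<open>A\<close>, too few for dimension 3.\<close>
    have "A \<subseteq> span {?x, e4}"
    proof
      fix y assume y: "y \<in> A"
      obtain a' b c d where [simp]: "y = comb a' b c d"
        by (rule comb_cases)
      have "b - a' / a * p = 0" "c - a' / a * q = 0"
        using eliminate_e1[OF sub x] y none by fastforce+
      then have y_eq: "y = (a' / a) *s ?x + (d - a' / a * r) *s e4"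
        using x(2) by (simp add: comb_scale comb_add_e4 comb_inject)
      show "y \<in> span {?x, e4}"
        unfolding y_eq by (intro span_add span_scale span_base) auto
    qed
    then have "dim A \<le> dim {?x, e4}"
      using dim_subset[of A "span {?x, e4}"] by simp
    also have "dim {?x, e4} \<le> 2"
      by (simp add: dim_insert)
    finally show False
      using dim by simp
  qed
  then have "e3 \<in> A" "e4 \<in> A"
    using derived_in_subalgebra[OF A x] by blast+
  then show thesis
    using eq_P_if_derived_in[OF sub dim] that by blast
qed

lemma subalgebras_of_dim_3: "subalgebras_of_dim 3 = {P l m | l m. (l, m) \<noteq> (0, 0)}"
proof (intro equalityI subsetI)
  fix A assume "A \<in> subalgebras_of_dim 3"
  then show "A \<in> {P l m | l m. (l, m) \<noteq> (0, 0)}"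
    using dim3_subalgebra_cases[of A] unfolding subalgebras_of_dim_def by blast
next
  fix A assume "A \<in> {P l m | l m. (l, m) \<noteq> (0, 0)}"
  then obtain l m where "(l, m) \<noteq> (0, 0)" "A = P l m"
    by blast
  then show "A \<in> subalgebras_of_dim 3"
    using subalgebra_P[of l m] dim_P[of l m] by (simp add: subalgebras_of_dim_def)
qed

section \<open>Classification of the two-dimensional subalgebras\<close>

lemma dim2_subalgebra_cases:
  assumes A: "subalgebra A" and dim: "dim A = 2"
  obtains (inside) "A \<subseteq> V" | (outside) a b where "A = Q a b"
proof (cases "A \<subseteq> V")
  case False
  note sub = subalgebra_subspace[OF A]
  obtain a p q r where x: "comb a p q r \<in> A" "a \<noteq> 0"
    using False by (rule not_in_V_cases)
  let ?x = "comb a p q r"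
  have "dim {?x} < dim A"
    using dim by simp
  then obtain y where y: "y \<in> A" "y \<notin> span {?x}"
    by (rule not_subset_if_dim_less)
  obtain a' b0 c0 d0 where y_eq: "y = comb a' b0 c0 d0"
    by (rule comb_cases)
  \<comment> \<open>Coordinates of \<open>y - (a' / a) *s ?x\<close>, the part of \<open>y\<close>
    in \<open>V\<close>.\<close>
  define b c d where "b = b0 - a' / a * p" and "c = c0 - a' / a * q" and "d = d0 - a' / a * r"
  have y': "comb 0 b c d \<in> A"
    using eliminate_e1[OF sub x] y(1) unfolding y_eq b_def c_def d_def by blast
  have "y = (a' / a) *s ?x + comb 0 b c d"
    using x(2) by (simp add: y_eq b_def c_def d_def comb_simps)
  then have nz: "comb 0 b c d \<noteq> 0"
    using y(2) span_scale[OF span_base, of ?x "{?x}" "a' / a"] by auto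
  \<comment> \<open>Otherwise \<open>e3\<close> and \<open>e4\<close> lie in \<open>A\<close>, and
    together with \<open>?x\<close> they force the three-dimensional \<open>P a p\<close> into
    \<open>A\<close>.\<close>
  have "b = 0 \<and> c = 0"
  proof (rule ccontr)
    assume "\<not> (b = 0 \<and> c = 0)"
    then have e: "e3 \<in> A" "e4 \<in> A"
      using derived_in_subalgebra[OF A x y'] by blast+
    then have "P a p \<subseteq> A"
      using comb_mod_e3_e4[OF sub e x(1)] P_subset_iff[OF sub] by blast
    then have "dim (P a p) \<le> dim A"
      by (rule dim_subset)
    then show False
      using dim dim_P[of a p] x(2) by simp
  qed
  then have e4: "e4 \<in> A"
    using in_subspace_scaleD[OF sub, of d e4] y' nz by (auto simp: comb_eq_0) (simp add: comb_def)
  \<comment> \<open>Normalising \<open>?x\<close> to leading coefficient 1 and removing its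
    \<open>e4\<close> part exhibits the generator of \<open>Q\<close>.\<close>
  have "inverse a *s (?x - r *s e4) \<in> A"
    using x(1) e4 by (intro subspace_scale subspace_diff sub)
  moreover have "inverse a *s (?x - r *s e4) = comb 1 (p / a) (q / a) 0"
    using x(2) by (simp add: comb_diff_scale comb_scale divide_inverse mult.commute)
  ultimately have "e1 + (p / a) *s e2 + (q / a) *s e3 \<in> A"
    by (simp add: comb_def)
  then have "Q (p / a) (q / a) \<subseteq> A"
    using e4 by (intro span_minimal sub) auto
  then have "Q (p / a) (q / a) = A"
    by (intro subspace_dim_equal) (auto simp only: sub subspace_span dim_Q dim)
  then show thesis
    using outside by blast
qed (rule inside)

lemma subalgebras_of_dim_2:
  "subalgebras_of_dim 2 = {W. subspace W \<and> W \<subseteq> V \<and> dim W = 2} \<union> {Q a b | a b. True}"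
proof (intro equalityI subsetI)
  fix A assume "A \<in> subalgebras_of_dim 2"
  then have A: "subalgebra A" "dim A = 2"
    by (simp_all add: subalgebras_of_dim_def)
  show "A \<in> {W. subspace W \<and> W \<subseteq> V \<and> dim W = 2} \<union> {Q a b | a b. True}"
    by (rule dim2_subalgebra_cases[OF A]) (use A subalgebra_subspace in blast)+
next
  fix A assume "A \<in> {W. subspace W \<and> W \<subseteq> V \<and> dim W = 2} \<union> {Q a b | a b. True}"
  then show "A \<in> subalgebras_of_dim 2"
  proof (elim UnE CollectE conjE exE)
    assume A: "subspace A" "A \<subseteq> V" "dim A = 2"
    \<comment> \<open>All brackets in \<open>V\<close> are zero, so each subspace of
      \<open>V\<close> is closed under them.\<close>
    have "bracket x y \<in> A" if "x \<in> A" "y \<in> A" for x y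
      using abelian_V that A(2) subspace_0[OF A(1)] unfolding abelian_def by (metis subsetD)
    then show ?thesis
      using A by (simp add: subalgebras_of_dim_def subalgebra_def)
  next
    fix a b assume "A = Q a b"
    then show ?thesis
      by (simp only: subalgebras_of_dim_def subalgebra_Q dim_Q mem_Collect_eq simp_thms)
  qed
qed

section \<open>Counting the three-dimensional subalgebras\<close>

lemma P_normalize:
  assumes "l \<noteq> 0"
  shows "P l m = P 1 (m / l)"
proof (intro set_eqI)
  fix x
  obtain a b c d where x: "x = comb a b c d"
    by (rule comb_cases)
  have "(\<exists>t. a = t * l \<and> b = t * m) \<longleftrightarrow> b = a * (m / l)"
    using assms by (auto intro: exI[of _ "a / l"])
  then show "x \<in> P l m \<longleftrightarrow> x \<in> P 1 (m / l)"
    unfolding x comb_in_P by simp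
qed

lemma P_0_normalize: "m \<noteq> 0 \<Longrightarrow> P 0 m = P 0 1"
proof -
  assume m: "m \<noteq> 0"
  have "P 0 m \<subseteq> V"
    by (rule span_minimal) (auto intro: span_base span_scale subspace_span)
  then have "P 0 m = V"
    using m by (intro subspace_dim_equal) (simp_all only: subspace_span dim_V dim_P, simp)
  then show ?thesis
    using V_eq_P by simp
qed

text \<open>The pairs \<open>(l, m)\<close> matter only up to scaling and so form a projective line:
  the affine points \<open>P 1 m\<close> and the point at infinity \<open>P 0 1\<close>.\<close>

lemma subalgebras_of_dim_3_normalized: "subalgebras_of_dim 3 = insert (P 0 1) (range (P 1))"
proof -
  have "P l m \<in> insert (P 0 1) (range (P 1))" if "(l, m) \<noteq> (0, 0)" for l m
    using that P_normalize[of l m] P_0_normalize[of m] by (cases "l = 0") auto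
  moreover have "P 1 m \<in> {P l m | l m. (l, m) \<noteq> (0, 0)}" for m
    by (intro CollectI exI[of _ 1] exI[of _ m]) simp
  moreover have "P 0 1 \<in> {P l m | l m. (l, m) \<noteq> (0, 0)}"
    by (intro CollectI exI[of _ 0] exI[of _ 1]) simp
  ultimately show ?thesis
    unfolding subalgebras_of_dim_3 by blast
qed

lemma card_subalgebras_of_dim_3:
  assumes fin: "finite (UNIV :: 'k set)"
  shows "card (subalgebras_of_dim 3) = CARD('k) + 1"
proof -
  have "inj (P 1)"
  proof (rule injI)
    fix m m' assume eq: "P 1 m = P 1 m'"
    have "comb 1 m 0 0 \<in> P 1 m"
      unfolding comb_in_P by simp
    then have "comb 1 m 0 0 \<in> P 1 m'"
      by (simp only: eq)
    then show "m = m'"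
      unfolding comb_in_P by simp
  qed
  moreover have "P 0 1 \<notin> range (P 1)"
  proof
    assume "P 0 1 \<in> range (P 1)"
    then obtain m where eq: "P 0 1 = P 1 m"
      by blast
    have "comb 0 1 0 0 \<in> P 0 1"
      unfolding comb_in_P by simp
    then have "comb 0 1 0 0 \<in> P 1 m"
      by (simp only: eq)
    then show False
      unfolding comb_in_P by simp
  qed
  ultimately show ?thesis
    using fin by (simp add: subalgebras_of_dim_3_normalized card_image)
qed

section \<open>Counting the two-dimensional subalgebras\<close>

text \<open>
  The planes in \<open>V\<close> in reduced echelon form: \<open>span {e3, e4}\<close> and the following two families.
\<close>

abbreviation "R1 s \<equiv> span {e2 + s *s e3, e4}"
abbreviation "R2 s t \<equiv> span {e2 + s *s e4, e3 + t *s e4}"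

lemma comb_in_R1: "comb a b c d \<in> R1 s \<longleftrightarrow> a = 0 \<and> c = b * s"
  by (simp add: span_breakdown_eq comb_diff_scale comb_eq_0)

lemma comb_in_R2: "comb a b c d \<in> R2 s t \<longleftrightarrow> a = 0 \<and> d = b * s + c * t"
  by (simp add: span_breakdown_eq comb_diff_scale comb_eq_0) (auto simp: algebra_simps)

lemma dim_R1: "dim (R1 s) = 2"
  unfolding dim_span
proof (rule dim_pair)
  show "e4 \<noteq> 0"
    using comb_eq_0[of 0 0 0 1] by (simp add: comb_def)
  show "e2 + s *s e3 - k *s e4 \<noteq> 0" for k
    using comb_eq_0[of 0 1 s "- k"] by (simp add: comb_def algebra_simps)
qed

lemma dim_R2: "dim (R2 s t) = 2"
  unfolding dim_span
proof (rule dim_pair)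
  show "e3 + t *s e4 \<noteq> 0"
    using comb_eq_0[of 0 0 1 t] by (simp add: comb_def)
  show "e2 + s *s e4 - k *s (e3 + t *s e4) \<noteq> 0" for k
    using comb_eq_0[of 0 1 "- k" "s - k * t"] by (simp add: comb_def algebra_simps)
qed

text \<open>If \<open>e4\<close> lies in \<open>W\<close>, a second vector reduced modulo
  \<open>e4\<close> gives \<open>span {e3, e4}\<close> or some \<open>R1 s\<close>. If not,
  \<open>W\<close> is a complement of the line of \<open>e4\<close> in \<open>V\<close>, hence a
  graph over the plane of \<open>e2\<close> and \<open>e3\<close>, which is
  \<open>R2\<close>.\<close>

lemma planes_in_V:
  "{W. subspace W \<and> W \<subseteq> V \<and> dim W = 2} =
    insert (span {e3, e4}) (range R1) \<union> range (\<lambda>(s, t). R2 s t)"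
proof (intro equalityI subsetI)
  fix W assume "W \<in> {W. subspace W \<and> W \<subseteq> V \<and> dim W = 2}"
  then have W: "subspace W" "W \<subseteq> V" "dim W = 2"
    by auto
  have eqI: "W = span B" if "B \<subseteq> W" "dim (span B) = 2" for B
    using subspace_dim_equal[of "span B" W] span_minimal[OF that(1) W(1)] that(2) W by simp
  show "W \<in> insert (span {e3, e4}) (range R1) \<union> range (\<lambda>(s, t). R2 s t)"
  proof (cases "e4 \<in> W")
    case True
    have "dim {e4} < dim W"
      using W(3) by simp
    then obtain w where w: "w \<in> W" "w \<notin> span {e4}"
      by (rule not_subset_if_dim_less)
    obtain b c d where w_eq: "w = comb 0 b c d"
      using w(1) W(2) by (cases w rule: comb_cases) (auto simp: comb_in_V)
    have "w - d *s e4 \<in> W"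
      by (intro subspace_diff subspace_scale W(1) w(1) True)
    then have bc: "comb 0 b c 0 \<in> W"
      by (simp add: w_eq comb_def)
    show ?thesis
    proof (cases "b = 0")
      case [simp]: True
      have "c \<noteq> 0"
        using w(2) by (auto simp: w_eq comb_def span_base span_scale)
      then have "e3 \<in> W"
        using bc in_subspace_scaleD[OF W(1), of c e3] by (simp add: comb_def)
      then show ?thesis
        using eqI[of "{e3, e4}"] \<open>e4 \<in> W\<close> dim_span34 by simp
    next
      case False
      have "inverse b *s comb 0 b c 0 \<in> W"
        by (rule subspace_scale[OF W(1) bc])
      moreover have "inverse b *s comb 0 b c 0 = comb 0 1 (c / b) 0"
        using False by (simp add: comb_scale divide_inverse mult.commute)
      ultimately have "e2 + (c / b) *s e3 \<in> W"
        by (simp add: comb_def)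
      then have "W = R1 (c / b)"
        using True by (intro eqI dim_R1) auto
      then show ?thesis
        by blast
    qed
  next
    case False
    have "V = span (insert e4 W)"
    proof (rule subspace_dim_equal[symmetric])
      show "span (insert e4 W) \<subseteq> V"
        using W(2) by (intro span_minimal) (auto intro: span_base)
      show "dim V \<le> dim (span (insert e4 W))"
        using False W by (simp only: dim_V dim_span dim_insert span_eq_iff[THEN iffD2, OF W(1)]) simp
    qed auto
    then have "e2 \<in> span (insert e4 W)" "e3 \<in> span (insert e4 W)"
      by (auto intro: span_base)
    then obtain s t where "e2 - s *s e4 \<in> W" "e3 - t *s e4 \<in> W"
      using W(1) by (auto simp: span_breakdown_eq span_eq_iff[THEN iffD2, OF W(1)])
    \<comment> \<open>The breakdown subtracts multiples of \<open>e4\<close> while \<open>R2\<close>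
      adds them, hence the signs.\<close>
    then have "W = R2 (- s) (- t)"
      by (intro eqI dim_R2) auto
    then show ?thesis
      by blast
  qed
next
  fix W assume "W \<in> insert (span {e3, e4}) (range R1) \<union> range (\<lambda>(s, t). R2 s t)"
  then consider "W = span {e3, e4}" | s where "W = R1 s" | s t where "W = R2 s t"
    by auto
  then show "W \<in> {W. subspace W \<and> W \<subseteq> V \<and> dim W = 2}"
  proof cases
    case 1
    then show ?thesis
      using dim_span34 by (auto intro!: span_mono)
  next
    case 2
    have "W \<subseteq> V"
      unfolding 2 by (intro span_minimal) (auto intro!: span_add span_scale intro: span_base)
    then show ?thesis
      using 2 dim_R1 by simp
  next
    case 3
    have "W \<subseteq> V"
      unfolding 3 by (intro span_minimal) (auto intro!: span_add span_scale intro: span_base)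
    then show ?thesis
      using 3 dim_R2 by simp
  qed
qed

text \<open>The parameter can be read off from the one vector of the plane with \<open>e2\<close>
  coordinate 1 and \<open>e4\<close> coordinate 0.\<close>

lemma inj_R1: "inj R1"
proof (rule injI)
  fix s s' assume eq: "R1 s = R1 s'"
  have "comb 0 1 s 0 \<in> R1 s"
    unfolding comb_in_R1 by simp
  then show "s = s'"
    unfolding eq comb_in_R1 by simp
qed

lemma inj_R2: "inj (\<lambda>(s, t). R2 s t)"
proof (rule injI, clarify)
  fix s t s' t' assume eq: "R2 s t = R2 s' t'"
  have "comb 0 1 0 s \<in> R2 s t" "comb 0 0 1 t \<in> R2 s t"
    unfolding comb_in_R2 by simp_all
  then show "s = s' \<and> t = t'"
    unfolding eq comb_in_R2 by simp
qed

lemma inj_Q: "inj (\<lambda>(a, b). Q a b)"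
proof (rule injI, clarify)
  fix a b a' b' assume eq: "Q a b = Q a' b'"
  have "comb 1 a b 0 \<in> Q a b"
    unfolding comb_in_Q by simp
  then show "a = a' \<and> b = b'"
    unfolding eq comb_in_Q by simp
qed

text \<open>With \<open>q\<close> field elements the contributions are \<open>1\<close> from
  \<open>span {e3, e4}\<close>, \<open>q\<close> from \<open>R1\<close>, \<open>q^2\<close> from
  \<open>R2\<close> and \<open>q^2\<close> from \<open>Q\<close>. Containing \<open>e4\<close>
  separates the first two families from \<open>R2\<close>; not lying in \<open>V\<close> separates
  \<open>Q\<close> from the rest.\<close>

lemma card_subalgebras_of_dim_2:
  assumes fin: "finite (UNIV :: 'k set)"
  shows "card (subalgebras_of_dim 2) = 2 * CARD('k)^2 + CARD('k) + 1"
proof -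
  let ?R1 = "range R1" and ?R2 = "range (\<lambda>(s, t). R2 s t)" and ?Q = "range (\<lambda>(a, b). Q a b)"
  have "span {e3, e4} \<noteq> R1 s" for s
    using comb_in_R1[of 0 1 s 0 s] comb_in_span34[of 0 1 s 0] by auto
  then have notin: "span {e3, e4} \<notin> ?R1"
    by blast
  have "e4 \<in> W" if "W \<in> insert (span {e3, e4}) ?R1" for W
    using that by (auto intro: span_base)
  moreover have "e4 \<notin> W" if "W \<in> ?R2" for W
    using that comb_in_R2[of 0 0 0 1] by (auto simp: comb_def)
  ultimately have disj: "insert (span {e3, e4}) ?R1 \<inter> ?R2 = {}"
    by (meson disjoint_iff)
  have "\<not> Q a b \<subseteq> V" for a b
    using comb_in_Q[of 1 a b 0 a b] comb_in_V[of 1 a b 0] by auto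
  then have disj': "{W. subspace W \<and> W \<subseteq> V \<and> dim W = 2} \<inter> ?Q = {}"
    by blast
  have finprod: "finite (UNIV :: ('k \<times> 'k) set)"
    using fin by (simp add: finite_prod)
  have Q: "{Q a b | a b. True} = ?Q"
    by auto
  have "card {W. subspace W \<and> W \<subseteq> V \<and> dim W = 2} = (CARD('k) + 1) + CARD('k)^2"
    unfolding planes_in_V
    using fin finprod notin disj
    by (simp add: card_Un_disjoint card_image inj_R1 inj_R2 power2_eq_square)
  moreover have "card ?Q = CARD('k)^2"
    by (simp add: card_image inj_Q power2_eq_square)
  moreover have "finite {W. subspace W \<and> W \<subseteq> V \<and> dim W = 2}"
    unfolding planes_in_V using fin finprod by simp
  ultimately show ?thesis
    unfolding subalgebras_of_dim_2 Q
    using finprod disj' by (simp add: card_Un_disjoint)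
qed

section \<open>Adjacency in the comaximal graph\<close>

lemma proper_nonzero_if_dim: "0 < dim A \<Longrightarrow> dim A < 4 \<Longrightarrow> A \<noteq> {0} \<and> A \<noteq> UNIV"
  using dim_whole by auto

text \<open>The strict chain \<open>dim B < dim ?G < 4\<close> starts at 2 or more, which leaves
  only one possibility.\<close>

lemma proper_generated_dim:
  assumes "subalgebra A" "subalgebra B" "2 \<le> dim B" "\<not> A \<subseteq> B"
    and "generated_subalgebra (A \<union> B) \<noteq> UNIV"
  shows "dim (generated_subalgebra (A \<union> B)) = 3" "dim B = 2"
proof -
  let ?G = "generated_subalgebra (A \<union> B)"
  have G: "subspace ?G" "A \<union> B \<subseteq> ?G"
    using subalgebra_subspace subalgebra_generated generated_superset by blast+
  have "dim B < dim ?G"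
  proof (rule ccontr)
    assume "\<not> dim B < dim ?G"
    then have "B = ?G"
      using G by (intro subspace_dim_equal subalgebra_subspace[OF assms(2)]) simp_all
    then show False
      using G(2) assms(4) by blast
  qed
  moreover have "dim ?G < dim UNIV"
    using subspace_dim_equal[OF G(1) subspace_UNIV subset_UNIV] assms(5) not_less by blast
  ultimately show "dim ?G = 3" "dim B = 2"
    using assms(3) dim_whole by linarith+
qed

lemma adj_dim_3:
  assumes "A \<in> subalgebras_of_dim 3" "B \<in> subalgebras_of_dim 3" "A \<noteq> B"
  shows "A \<rightarrow>\<^bsub>comaximal_graph\<^esub> B"
proof -
  have A: "subalgebra A" "dim A = 3" and B: "subalgebra B" "dim B = 3"
    using assms by (simp_all add: subalgebras_of_dim_def)
  have "\<not> A \<subseteq> B"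
    using subspace_dim_equal[of A B] A B assms(3) subalgebra_subspace by auto
  \<comment> \<open>A proper generated subalgebra would force \<open>dim B = 2\<close>, against
    \<open>dim B = 3\<close>.\<close>
  then have "generated_subalgebra (A \<union> B) = UNIV"
    using proper_generated_dim(2)[OF A(1) B(1)] B(2) by fastforce
  then show ?thesis
    using proper_nonzero_if_dim[of A] proper_nonzero_if_dim[of B] A B assms(3)
    unfolding comaximal_graph_adj by simp
qed

lemma dim_2_subset_dim_3:
  assumes "B \<in> subalgebras_of_dim 2"
  shows "\<exists>M\<in>subalgebras_of_dim 3. B \<subseteq> M"
proof -
  have B: "subalgebra B" "dim B = 2"
    using assms by (simp_all add: subalgebras_of_dim_def)
  then show ?thesis
  proof (cases rule: dim2_subalgebra_cases)
    case inside
    then show ?thesis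
      unfolding subalgebras_of_dim_3_normalized V_eq_P by blast
  next
    case (outside a b)
    have "Q a b \<subseteq> P 1 a"
    proof
      fix x assume "x \<in> Q a b"
      then show "x \<in> P 1 a"
        by (cases x rule: comb_cases) (simp only: comb_in_P comb_in_Q, simp)
    qed
    then show ?thesis
      unfolding subalgebras_of_dim_3_normalized outside by blast
  qed
qed

text \<open>Lines and planes are treated together through \<open>n\<close>; \<open>0 < n\<close>
  makes \<open>A\<close> nonzero and thus a vertex.\<close>

lemma adj_dim_2_iff:
  assumes "A \<in> subalgebras_of_dim n" "0 < n" "n \<le> 2" "B \<in> subalgebras_of_dim 2"
  shows "A \<rightarrow>\<^bsub>comaximal_graph\<^esub> B \<longleftrightarrow> \<not> (\<exists>M\<in>subalgebras_of_dim 3. A \<subseteq> M \<and> B \<subseteq> M)"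
proof -
  have A: "subalgebra A" "dim A = n" and B: "subalgebra B" "dim B = 2"
    using assms by (simp_all add: subalgebras_of_dim_def)
  let ?G = "generated_subalgebra (A \<union> B)"
  have not_UNIV: "?G \<noteq> UNIV" if "M \<in> subalgebras_of_dim 3" "A \<subseteq> M" "B \<subseteq> M" for M
    using that generated_minimal[of "A \<union> B" M] proper_nonzero_if_dim[of M]
    by (auto simp: subalgebras_of_dim_def)
  have UNIV: "?G = UNIV \<and> A \<noteq> B" if no: "\<not> (\<exists>M\<in>subalgebras_of_dim 3. A \<subseteq> M \<and> B \<subseteq> M)"
  proof -
    \<comment> \<open>This also yields \<open>A \<noteq> B\<close>, which adjacency demands.\<close>
    have nsub: "\<not> A \<subseteq> B"
      using no dim_2_subset_dim_3[OF assms(4)] by blast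
    moreover have "?G = UNIV"
    proof (rule ccontr)
      assume "?G \<noteq> UNIV"
      then have "?G \<in> subalgebras_of_dim 3"
        using proper_generated_dim(1)[OF A(1) B(1) _ nsub] B(2) subalgebra_generated
        by (simp add: subalgebras_of_dim_def)
      then show False
        using no generated_superset[of "A \<union> B"] by blast
    qed
    ultimately show ?thesis
      by blast
  qed
  have proper: "A \<noteq> {0} \<and> A \<noteq> UNIV" "B \<noteq> {0} \<and> B \<noteq> UNIV"
    using proper_nonzero_if_dim[of A] proper_nonzero_if_dim[of B] A B assms(2,3) by simp_all
  show ?thesis
  proof
    assume "A \<rightarrow>\<^bsub>comaximal_graph\<^esub> B"
    then have "?G = UNIV"
      unfolding comaximal_graph_adj by simp
    then show "\<not> (\<exists>M\<in>subalgebras_of_dim 3. A \<subseteq> M \<and> B \<subseteq> M)"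
      using not_UNIV by blast
  next
    assume "\<not> (\<exists>M\<in>subalgebras_of_dim 3. A \<subseteq> M \<and> B \<subseteq> M)"
    then show "A \<rightarrow>\<^bsub>comaximal_graph\<^esub> B"
      unfolding comaximal_graph_adj using UNIV proper A(1) B(1) by simp
  qed
qed

lemma complete_digraph_dim_3:
  assumes fin: "finite (UNIV :: 'k set)"
  shows "K\<^bsub>CARD('k) + 1\<^esub> (with_proj comaximal_graph \<restriction> subalgebras_of_dim 3)"
proof -
  let ?P = "subalgebras_of_dim 3"
  \<comment> \<open>A pair digraph standing for the induced subgraph, so that
    \<open>complete_digraph_pair_def\<close>, which speaks of graphs of the form
    \<open>with_proj\<close>, can be applied.\<close>
  let ?H = "\<lparr>pverts = ?P, parcs = {(A, B). (A, B) \<in> ?P \<times> ?P \<and> A \<noteq> B}\<rparr>"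
  have "(A, B) \<in> parcs comaximal_graph \<longleftrightarrow> A \<noteq> B" if "A \<in> ?P" "B \<in> ?P" for A B
    using adj_dim_3[OF that] by (auto simp: comaximal_graph_def Let_def)
  then have "with_proj comaximal_graph \<restriction> ?P = with_proj ?H"
    by (auto simp: induce_subgraph_def with_proj_def)
  moreover have "card ?P = CARD('k) + 1" "finite ?P"
    using card_subalgebras_of_dim_3[OF fin] by (auto intro: card_ge_0_finite)
  ultimately show ?thesis
    by (simp add: complete_digraph_pair_def)
qed

end

theorem proposition4p4:
  fixes scale :: "'k::field \<Rightarrow> 'v::ab_group_add \<Rightarrow> 'v" (infixr \<open>*s\<close> 75)
    and bracket :: "'v \<Rightarrow> 'v \<Rightarrow> 'v"
    and e1 e2 e3 e4 :: 'v
    and P1 P2 P3 :: "'v set set"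
    and P3_form :: "'k \<Rightarrow> 'k \<Rightarrow> 'v set"
    and \<Gamma> :: "'v set pair_pre_digraph"
  assumes L: "filiform4 scale bracket e1 e2 e3 e4"
    and P1: "P1 = lie_algebra.subalgebras_of_dim scale bracket 1"
    and P2: "P2 = lie_algebra.subalgebras_of_dim scale bracket 2"
    and P3: "P3 = lie_algebra.subalgebras_of_dim scale bracket 3"
    and P3_form: "P3_form = (\<lambda>l m. module.span scale {e3, e4, l *s e1 + m *s e2})"
    and \<Gamma>: "\<Gamma> = lie_algebra.comaximal_graph scale bracket"
  shows
    "(P3 = {P3_form l m | l m. (l, m) \<noteq> (0, 0)}
      \<and> (\<forall>l m. l \<noteq> 0 \<longrightarrow> lie_algebra.heisenberg scale bracket (P3_form l m))
      \<and> (\<forall>m. m \<noteq> 0 \<longrightarrow> lie_algebra.abelian bracket (P3_form 0 m))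
      \<and> (finite (UNIV :: 'k set) \<longrightarrow> card P3 = CARD('k) + 1))
    \<and> (P2 = {W. module.subspace scale W \<and> W \<subseteq> module.span scale {e2, e3, e4}
                  \<and> vector_space.dim scale W = 2}
              \<union> {module.span scale {e1 + a *s e2 + b *s e3, e4} | a b. True}
      \<and> (finite (UNIV :: 'k set) \<longrightarrow> card P2 = 2 * CARD('k)^2 + CARD('k) + 1))
    \<and> ((\<forall>A\<in>P3. \<forall>B\<in>P3. A \<noteq> B \<longrightarrow> A \<rightarrow>\<^bsub>\<Gamma>\<^esub> B)
      \<and> (finite (UNIV :: 'k set) \<longrightarrow> K\<^bsub>CARD('k) + 1\<^esub> (with_proj \<Gamma> \<restriction> P3)))
    \<and> (\<forall>A\<in>P2. \<forall>B\<in>P2. A \<rightarrow>\<^bsub>\<Gamma>\<^esub> B \<longleftrightarrow> \<not> (\<exists>M\<in>P3. A \<subseteq> M \<and> B \<subseteq> M))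
    \<and> (\<forall>A\<in>P1. \<forall>B\<in>P2. A \<rightarrow>\<^bsub>\<Gamma>\<^esub> B \<longleftrightarrow> \<not> (\<exists>M\<in>P3. A \<subseteq> M \<and> B \<subseteq> M))"
proof -
  interpret filiform4 scale bracket e1 e2 e3 e4
    by (rule L)
  show ?thesis
    unfolding P1 P2 P3 P3_form \<Gamma>
  proof (intro conjI allI ballI impI)
    show "subalgebras_of_dim 3 = {P l m | l m. (l, m) \<noteq> (0, 0)}"
      by (rule subalgebras_of_dim_3)
    show "subalgebras_of_dim 2 =
        {W. subspace W \<and> W \<subseteq> V \<and> dim W = 2} \<union> {Q a b | a b. True}"
      by (rule subalgebras_of_dim_2)
  \<comment> \<open>The two instances of \<open>adj_dim_2_iff\<close> take \<open>n = 2\<close> for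
    claim (4) and \<open>n = 1\<close> for claim (5).\<close>
  qed (fact heisenberg_P abelian_P_0 card_subalgebras_of_dim_3 card_subalgebras_of_dim_2
      adj_dim_3 complete_digraph_dim_3 adj_dim_2_iff[OF _ zero_less_numeral order_refl]
      adj_dim_2_iff[OF _ zero_less_one one_le_numeral])+
qed

end
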